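(* There is a point $z^0\in\ell_2^2(\mathbf{N})$ such that for every function $h:\mathbf{R}_+\to(0,1)$ that strictly decreases to zero, there exist two closed subspaces $U,V\subseteq\ell_2^2(\mathbf{N})$ with $U\cap V=\{0\}$ such that the relaxed Peaceman-Rachford sequence $(z^j)_{j\ge0}$ started at $z^0$ and generated with the functions $f=\iota_V$ and $g=\iota_U$ and relaxation parameters $\lambda_k\equiv1/2$, i.e. $z^{k+1}=\frac12(I+T_{\mathrm{PRS}})(z^k)$, satisfies, for a fixed point $z^\ast$ of $T_{\mathrm{PRS}}$, the bound $$\|z^k-z^\ast\|\ge e^{-1}h(k)\qquad\text{for all }k\ge0,$$ but $(\|z^j-z^\ast\|)_{j\ge0}$ converges to $0$.
   Context: $\ell_2^2(\mathbf{N})=\{(z_j)_{j\ge0}\mid z_j\in\mathbf{R}^2\ \forall j,\ \sum_{j=0}^\infty\|z_j\|^2<\infty\}$, with its natural Hilbert space structure. $\iota_C$ is the indicator function of $C$ ($0$ on $C$, $+\infty$ off $C$). For $\gamma>0$, $\mathbf{prox}_{\gamma f}(x):=\arg\min_{y}f(y)+\frac{1}{2\gamma}\|y-x\|^2$, $\mathbf{refl}_{\gamma f}:=2\mathbf{prox}_{\gamma f}-I$, $T_{\mathrm{PRS}}:=\mathbf{refl}_{\gamma f}\circ\mathbf{refl}_{\gamma g}$; for indicators of closed subspaces the prox is the orthogonal projection, independent of $\gamma$. *)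

theory Defs
  imports "HOL-Analysis.Analysis"
begin

typedef (overloaded) ('a::real_inner) ell2 =
  "{z :: nat \<Rightarrow> 'a. summable (\<lambda>j. (norm (z j))\<^sup>2)}"
  morphisms ell2_nth Abs_ell2
proof
  show "(\<lambda>_. 0) \<in> {z :: nat \<Rightarrow> 'a. summable (\<lambda>j. (norm (z j))\<^sup>2)}" by simp
qed

setup_lifting type_definition_ell2

lemma norm_add_square_le:
  fixes a b :: "'a::real_inner"
  shows "(norm (a + b))\<^sup>2 \<le> 2 * (norm a)\<^sup>2 + 2 * (norm b)\<^sup>2"
proof -
  have "(norm (a + b))\<^sup>2 \<le> (norm a + norm b)\<^sup>2"
    by (intro power_mono norm_triangle_ineq) simp
  also have "\<dots> \<le> 2 * (norm a)\<^sup>2 + 2 * (norm b)\<^sup>2"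
    using sum_squares_bound[of "norm a" "norm b"] by (simp add: power2_sum)
  finally show ?thesis .
qed

lemma summable_norm_add_square:
  fixes x y :: "nat \<Rightarrow> 'a::real_inner"
  assumes "summable (\<lambda>j. (norm (x j))\<^sup>2)" "summable (\<lambda>j. (norm (y j))\<^sup>2)"
  shows "summable (\<lambda>j. (norm (x j + y j))\<^sup>2)"
proof (rule summable_comparison_test')
  show "summable (\<lambda>j. 2 * (norm (x j))\<^sup>2 + 2 * (norm (y j))\<^sup>2)"
    by (intro summable_add summable_mult assms)
  show "norm ((norm (x j + y j))\<^sup>2) \<le> 2 * (norm (x j))\<^sup>2 + 2 * (norm (y j))\<^sup>2" if "j \<ge> 0" for j
    using norm_add_square_le[of "x j" "y j"] by simp
qed

lemma summable_inner:
  fixes x y :: "nat \<Rightarrow> 'a::real_inner"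
  assumes "summable (\<lambda>j. (norm (x j))\<^sup>2)" "summable (\<lambda>j. (norm (y j))\<^sup>2)"
  shows "summable (\<lambda>j. x j \<bullet> y j)"
proof (rule summable_comparison_test')
  show "summable (\<lambda>j. (norm (x j))\<^sup>2 + (norm (y j))\<^sup>2)"
    by (intro summable_add assms)
  show "norm (x j \<bullet> y j) \<le> (norm (x j))\<^sup>2 + (norm (y j))\<^sup>2" if "j \<ge> 0" for j
  proof -
    have "\<bar>x j \<bullet> y j\<bar> \<le> norm (x j) * norm (y j)"
      by (rule Cauchy_Schwarz_ineq2)
    also have "\<dots> \<le> 2 * norm (x j) * norm (y j)"
      by simp
    also have "\<dots> \<le> (norm (x j))\<^sup>2 + (norm (y j))\<^sup>2"
      by (rule sum_squares_bound)
    finally show ?thesis by simp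
  qed
qed

lemma summable_ell2: "summable (\<lambda>j. (norm (ell2_nth z j))\<^sup>2)"
  using ell2_nth[of z] by simp

instantiation ell2 :: (real_inner) real_vector
begin

lift_definition zero_ell2 :: "'a ell2" is "\<lambda>_. 0" by simp

lift_definition plus_ell2 :: "'a ell2 \<Rightarrow> 'a ell2 \<Rightarrow> 'a ell2" is "\<lambda>x y j. x j + y j"
  by (rule summable_norm_add_square)

lift_definition uminus_ell2 :: "'a ell2 \<Rightarrow> 'a ell2" is "\<lambda>x j. - x j" by simp

lift_definition minus_ell2 :: "'a ell2 \<Rightarrow> 'a ell2 \<Rightarrow> 'a ell2" is "\<lambda>x y j. x j - y j"
  subgoal for x y using summable_norm_add_square[of x "\<lambda>j. - y j"] by simp
  done

lift_definition scaleR_ell2 :: "real \<Rightarrow> 'a ell2 \<Rightarrow> 'a ell2" is "\<lambda>r x j. r *\<^sub>R x j"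
  by (simp add: power_mult_distrib summable_mult)

instance
proof
  fix x y z :: "'a ell2" and r s :: real
  show "x + y + z = x + (y + z)" "x + y = y + x" "0 + x = x" "- x + x = 0" "x - y = x + - y"
    "r *\<^sub>R (x + y) = r *\<^sub>R x + r *\<^sub>R y" "(r + s) *\<^sub>R x = r *\<^sub>R x + s *\<^sub>R x"
    "r *\<^sub>R s *\<^sub>R x = (r * s) *\<^sub>R x" "1 *\<^sub>R x = x"
    by (transfer; simp add: fun_eq_iff algebra_simps)+
qed

end

text \<open>
  An auxiliary name for the norm: inside the instantiation below, the overloaded one
  is not yet available on the right-hand sides of the other definitions.
\<close>

definition l2_norm :: "'a::real_inner ell2 \<Rightarrow> real" where
  "l2_norm x = sqrt (\<Sum>j. (norm (ell2_nth x j))\<^sup>2)"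

instantiation ell2 :: (real_inner) real_inner
begin

definition inner_ell2 :: "'a ell2 \<Rightarrow> 'a ell2 \<Rightarrow> real" where
  "x \<bullet> y = (\<Sum>j. ell2_nth x j \<bullet> ell2_nth y j)"

definition norm_ell2 :: "'a ell2 \<Rightarrow> real" where
  "norm_ell2 x = l2_norm x"

definition dist_ell2 :: "'a ell2 \<Rightarrow> 'a ell2 \<Rightarrow> real" where
  "dist_ell2 x y = l2_norm (x - y)"

definition sgn_ell2 :: "'a ell2 \<Rightarrow> 'a ell2" where
  "sgn_ell2 x = x /\<^sub>R l2_norm x"

definition uniformity_ell2 :: "('a ell2 \<times> 'a ell2) filter" where
  "uniformity_ell2 = (INF e\<in>{0<..}. principal {(x, y). l2_norm (x - y) < e})"

definition open_ell2 :: "'a ell2 set \<Rightarrow> bool" where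
  "open_ell2 S = (\<forall>x\<in>S. \<forall>\<^sub>F (x', y) in (INF e\<in>{0<..}. principal {(x, y). l2_norm (x - y) < e}).
     x' = x \<longrightarrow> y \<in> S)"

instance
proof
  fix x y z :: "'a ell2" and r :: real
  show "dist x y = norm (x - y)" by (simp only: dist_ell2_def norm_ell2_def)
  show "sgn x = x /\<^sub>R norm x" by (simp only: sgn_ell2_def norm_ell2_def)
  show "uniformity = (INF e\<in>{0<..}. principal {(x :: 'a ell2, y). dist x y < e})"
    by (simp only: uniformity_ell2_def dist_ell2_def)
  show "open U = (\<forall>x\<in>U. \<forall>\<^sub>F (x', y) in uniformity. x' = x \<longrightarrow> y \<in> U)" for U :: "'a ell2 set"
    by (simp only: open_ell2_def uniformity_ell2_def)
  have inner_summable: "summable (\<lambda>j. ell2_nth u j \<bullet> ell2_nth v j)" for u v :: "'a ell2"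
    by (intro summable_inner summable_ell2)
  show "x \<bullet> y = y \<bullet> x"
    by (simp add: inner_ell2_def inner_commute)
  show "(x + y) \<bullet> z = x \<bullet> z + y \<bullet> z"
    by (simp add: inner_ell2_def plus_ell2.rep_eq inner_add_left suminf_add inner_summable)
  show "(r *\<^sub>R x) \<bullet> y = r * (x \<bullet> y)"
    by (simp add: inner_ell2_def scaleR_ell2.rep_eq suminf_mult inner_summable)
  show "0 \<le> x \<bullet> x"
    unfolding inner_ell2_def by (intro suminf_nonneg inner_summable) simp
  show "x \<bullet> x = 0 \<longleftrightarrow> x = 0"
  proof -
    have "x \<bullet> x = 0 \<longleftrightarrow> (\<forall>j. ell2_nth x j \<bullet> ell2_nth x j = 0)"
      unfolding inner_ell2_def by (intro suminf_eq_zero_iff inner_summable) simp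
    also have "\<dots> \<longleftrightarrow> x = 0"
      by (simp add: ell2_nth_inject[symmetric] zero_ell2.rep_eq fun_eq_iff)
    finally show ?thesis .
  qed
  show "norm x = sqrt (x \<bullet> x)"
    by (simp add: norm_ell2_def l2_norm_def inner_ell2_def power2_norm_eq_inner)
qed

end

lemma norm_ell2_power2: "(norm z)\<^sup>2 = (\<Sum>j. (norm (ell2_nth z j))\<^sup>2)"
  by (simp add: norm_ell2_def l2_norm_def suminf_nonneg summable_ell2)

lemma sum_le_norm_ell2_power2: "(\<Sum>j<n. (norm (ell2_nth z j))\<^sup>2) \<le> (norm z)\<^sup>2"
  unfolding norm_ell2_power2 by (intro sum_le_suminf summable_ell2) auto

lemma norm_ell2_nth_le: "norm (ell2_nth z j) \<le> norm z"
proof (rule power2_le_imp_le)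
  have "(norm (ell2_nth z j))\<^sup>2 \<le> (\<Sum>i<Suc j. (norm (ell2_nth z i))\<^sup>2)"
    by (simp add: sum_nonneg)
  then show "(norm (ell2_nth z j))\<^sup>2 \<le> (norm z)\<^sup>2"
    using sum_le_norm_ell2_power2[of z "Suc j"] by linarith
qed simp

instance ell2 :: ("{real_inner, complete_space}") complete_space
proof
  fix X :: "nat \<Rightarrow> 'a ell2"
  assume X: "Cauchy X"
  have "convergent (\<lambda>n. ell2_nth (X n) j)" for j
  proof (rule Cauchy_convergent, rule metric_CauchyI)
    fix e :: real assume "0 < e"
    then obtain M where M: "\<forall>m\<ge>M. \<forall>n\<ge>M. dist (X m) (X n) < e"
      using metric_CauchyD[OF X] by blast
    have "dist (ell2_nth (X m) j) (ell2_nth (X n) j) \<le> dist (X m) (X n)" for m n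
      using norm_ell2_nth_le[of "X m - X n" j] by (simp add: dist_norm minus_ell2.rep_eq)
    then show "\<exists>M. \<forall>m\<ge>M. \<forall>n\<ge>M. dist (ell2_nth (X m) j) (ell2_nth (X n) j) < e"
      using M by (meson le_less_trans)
  qed
  then obtain L where L: "\<And>j. (\<lambda>n. ell2_nth (X n) j) \<longlonglongrightarrow> L j"
    unfolding convergent_def by metis
  have tail: "\<exists>M. \<forall>m\<ge>M. \<forall>J. (\<Sum>j<J. (norm (ell2_nth (X m) j - L j))\<^sup>2) \<le> e\<^sup>2"
    if "0 < e" for e :: real
  proof -
    obtain M where M: "\<forall>m\<ge>M. \<forall>n\<ge>M. dist (X m) (X n) < e"
      using metric_CauchyD[OF X \<open>0 < e\<close>] by blast
    have "(\<Sum>j<J. (norm (ell2_nth (X m) j - L j))\<^sup>2) \<le> e\<^sup>2" if "m \<ge> M" for m J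
    proof (rule LIMSEQ_le_const2)
      show "(\<lambda>n. \<Sum>j<J. (norm (ell2_nth (X m) j - ell2_nth (X n) j))\<^sup>2)
          \<longlonglongrightarrow> (\<Sum>j<J. (norm (ell2_nth (X m) j - L j))\<^sup>2)"
        by (intro tendsto_intros L)
      have "(\<Sum>j<J. (norm (ell2_nth (X m) j - ell2_nth (X n) j))\<^sup>2) \<le> e\<^sup>2" if "n \<ge> M" for n
      proof -
        have "(\<Sum>j<J. (norm (ell2_nth (X m) j - ell2_nth (X n) j))\<^sup>2) \<le> (norm (X m - X n))\<^sup>2"
          using sum_le_norm_ell2_power2[of "X m - X n" J] by (simp add: minus_ell2.rep_eq)
        also have "\<dots> \<le> e\<^sup>2"
          using M \<open>m \<ge> M\<close> that by (intro power_mono) (auto simp: dist_norm less_imp_le)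
        finally show ?thesis .
      qed
      then show "\<exists>N. \<forall>n\<ge>N. (\<Sum>j<J. (norm (ell2_nth (X m) j - ell2_nth (X n) j))\<^sup>2) \<le> e\<^sup>2"
        by blast
    qed
    then show ?thesis by blast
  qed
  have diff_summable: "summable (\<lambda>j. (norm (ell2_nth (X m) j - L j))\<^sup>2)"
    if "\<forall>J. (\<Sum>j<J. (norm (ell2_nth (X m) j - L j))\<^sup>2) \<le> e\<^sup>2" for m e
    using that by (intro summableI_nonneg_bounded[where x = "e\<^sup>2"]) auto
  obtain M where M: "\<forall>J. (\<Sum>j<J. (norm (ell2_nth (X M) j - L j))\<^sup>2) \<le> 1\<^sup>2"
    using tail[of 1] by auto
  have "summable (\<lambda>j. (norm (ell2_nth (X M) j + - (ell2_nth (X M) j - L j)))\<^sup>2)"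
    using diff_summable[OF M] by (intro summable_norm_add_square summable_ell2) (simp add: norm_minus_commute)
  then have L_summable: "summable (\<lambda>j. (norm (L j))\<^sup>2)" by simp
  have nth_L: "ell2_nth (Abs_ell2 L) = L"
    using L_summable by (simp add: Abs_ell2_inverse)
  have "X \<longlonglongrightarrow> Abs_ell2 L"
  proof (rule metric_LIMSEQ_I)
    fix r :: real assume "0 < r"
    then obtain M where M: "\<forall>m\<ge>M. \<forall>J. (\<Sum>j<J. (norm (ell2_nth (X m) j - L j))\<^sup>2) \<le> (r/2)\<^sup>2"
      using tail[of "r/2"] by auto
    have "dist (X m) (Abs_ell2 L) < r" if "m \<ge> M" for m
    proof -
      have "(norm (X m - Abs_ell2 L))\<^sup>2 = (\<Sum>j. (norm (ell2_nth (X m) j - L j))\<^sup>2)"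
        by (simp add: norm_ell2_power2 minus_ell2.rep_eq nth_L)
      also have "\<dots> \<le> (r/2)\<^sup>2"
        using M that diff_summable[of m "r/2"] by (intro suminf_le_const) auto
      finally have "norm (X m - Abs_ell2 L) \<le> r/2"
        by (rule power2_le_imp_le) (use \<open>0 < r\<close> in simp)
      then show ?thesis using \<open>0 < r\<close> by (simp add: dist_norm)
    qed
    then show "\<exists>M. \<forall>m\<ge>M. dist (X m) (Abs_ell2 L) < r" by blast
  qed
  then show "convergent X" by (auto simp: convergent_def)
qed

definition indicator_fun :: "'a set \<Rightarrow> 'a \<Rightarrow> ereal" where
  "indicator_fun C x = (if x \<in> C then 0 else \<infinity>)"

text \<open>
  The value is meaningful when the minimizer exists and is unique, as it does for
  \<open>\<gamma> > 0\<close> and a proper, closed and convex \<open>f\<close> on a Hilbert space.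
\<close>

definition prox :: "real \<Rightarrow> ('a::real_inner \<Rightarrow> ereal) \<Rightarrow> 'a \<Rightarrow> 'a" where
  "prox \<gamma> f x = (ARG_MIN (\<lambda>y. f y + ereal (1 / (2 * \<gamma>) * (norm (y - x))\<^sup>2)) y. True)"

definition reflection :: "real \<Rightarrow> ('a::real_inner \<Rightarrow> ereal) \<Rightarrow> 'a \<Rightarrow> 'a" where
  "reflection \<gamma> f x = 2 *\<^sub>R prox \<gamma> f x - x"

definition T_PRS :: "real \<Rightarrow> ('a::real_inner \<Rightarrow> ereal) \<Rightarrow> ('a \<Rightarrow> ereal) \<Rightarrow> 'a \<Rightarrow> 'a" where
  "T_PRS \<gamma> f g = reflection \<gamma> f \<circ> reflection \<gamma> g"

primrec relaxed_PRS ::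
  "real \<Rightarrow> (nat \<Rightarrow> real) \<Rightarrow> ('a::real_inner \<Rightarrow> ereal) \<Rightarrow> ('a \<Rightarrow> ereal) \<Rightarrow> 'a \<Rightarrow> nat \<Rightarrow> 'a" where
  "relaxed_PRS \<gamma> lam f g z0 0 = z0"
| "relaxed_PRS \<gamma> lam f g z0 (Suc k) =
    (1 - lam k) *\<^sub>R relaxed_PRS \<gamma> lam f g z0 k + lam k *\<^sub>R T_PRS \<gamma> f g (relaxed_PRS \<gamma> lam f g z0 k)"

end

theory Submission
  imports Defs
begin

text \<open>
  In each coordinate plane take two lines at a small angle with cosine \<open>c j\<close>. The relaxed map is
  then \<open>c j\<close> times a rotation, so the \<open>j\<close>-th coordinate decays exactly like \<open>c j ^ k\<close>. The
  starting point has coordinates of norm \<open>2\<^sup>-\<^sup>j\<close>; if \<open>h k \<le> 2\<^sup>-\<^sup>j\<close> for all \<open>k \<ge> N j\<close>, choosing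
  \<open>c j\<close> so close to \<open>1\<close> that \<open>c j ^ k \<ge> 1/e\<close> for all \<open>k \<le> N (j + 1)\<close> makes the \<open>j\<close>-th
  coordinate alone dominate \<open>h / e\<close> between the times \<open>N j\<close> and \<open>N (j + 1)\<close>.
\<close>

text \<open>By Pythagoras, moving from \<open>p\<close> to another point \<open>y\<close> of
  \<open>C\<close> raises the squared distance to \<open>x\<close> by the square of the norm of
  \<open>y - p\<close>. Points off \<open>C\<close> cost infinity, so \<open>p\<close> is the strict
  minimizer and the choice hidden in \<open>ARG_MIN\<close> can only return
  \<open>p\<close>.\<close>

lemma prox_indicator_fun_subspace:
  assumes "subspace C" "p \<in> C" "\<gamma> > 0" and orth: "\<And>y. y \<in> C \<Longrightarrow> (x - p) \<bullet> y = 0"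
  shows "prox \<gamma> (indicator_fun C) x = p"
proof -
  define F where "F y = indicator_fun C y + ereal (1 / (2 * \<gamma>) * (norm (y - x))\<^sup>2)" for y
  have "F p < F y" if "y \<noteq> p" for y
  proof (cases "y \<in> C")
    case True
    then have "(x - p) \<bullet> (y - p) = 0"
      using assms by (simp add: subspace_diff)
    then have "(norm (y - x))\<^sup>2 = (norm (y - p))\<^sup>2 + (norm (p - x))\<^sup>2"
      by (simp add: power2_norm_eq_inner inner_diff inner_commute algebra_simps)
    then have "(norm (p - x))\<^sup>2 < (norm (y - x))\<^sup>2"
      using that by simp
    then show ?thesis
      using True assms by (simp add: F_def indicator_fun_def divide_strict_right_mono)
  next
    case False
    then show ?thesis
      using \<open>p \<in> C\<close> by (simp add: F_def indicator_fun_def)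
  qed
  then have "is_arg_min F (\<lambda>_. True) y \<longleftrightarrow> y = p" for y
    unfolding is_arg_min_def by (metis order_less_asym)
  then show ?thesis
    unfolding prox_def F_def[symmetric] arg_min_def by (intro some_equality) auto
qed

text \<open>For unit vectors \<open>u j\<close> this is the Hilbert sum of the lines spanned by the
  \<open>u j\<close>. Writing it as the fixed points of the coordinatewise projections makes it an
  intersection of sets cut out by continuous linear equations.\<close>

definition line_sum :: "(nat \<Rightarrow> 'a::real_inner) \<Rightarrow> 'a ell2 set" where
  "line_sum u = {z. \<forall>j. (ell2_nth z j \<bullet> u j) *\<^sub>R u j = ell2_nth z j}"

text \<open>\<open>Abs_ell2\<close> gives the intended value once the sequence is known to be square
  summable; for unit \<open>u j\<close> this follows from Cauchy-Schwarz, see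
  \<open>ell2_nth_line_proj\<close>.\<close>

definition line_proj :: "(nat \<Rightarrow> 'a::real_inner) \<Rightarrow> 'a ell2 \<Rightarrow> 'a ell2" where
  "line_proj u z = Abs_ell2 (\<lambda>j. (ell2_nth z j \<bullet> u j) *\<^sub>R u j)"

lemma bounded_linear_ell2_nth: "bounded_linear (\<lambda>z. ell2_nth z j)"
  by (rule bounded_linear_intro[where K = 1])
    (simp_all add: plus_ell2.rep_eq scaleR_ell2.rep_eq norm_ell2_nth_le)

lemma subspace_line_sum: "subspace (line_sum u)"
  by (auto simp: subspace_def line_sum_def zero_ell2.rep_eq plus_ell2.rep_eq scaleR_ell2.rep_eq
      inner_add_left scaleR_add_left simp flip: scaleR_scaleR)

lemma closed_line_sum: "closed (line_sum u)"
proof -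
  have "continuous_on UNIV (\<lambda>z. ell2_nth z j)" for j
    by (rule linear_continuous_on[OF bounded_linear_ell2_nth])
  then show ?thesis
    unfolding line_sum_def by (intro closed_Collect_all closed_Collect_eq continuous_intros)
qed

lemma ell2_nth_line_proj:
  assumes "\<And>j. norm (u j) = 1"
  shows "ell2_nth (line_proj u z) j = (ell2_nth z j \<bullet> u j) *\<^sub>R u j"
proof -
  have "(ell2_nth z j \<bullet> u j)\<^sup>2 \<le> (norm (ell2_nth z j))\<^sup>2" for j
    using Cauchy_Schwarz_ineq2[of "ell2_nth z j" "u j"] assms by (simp add: abs_le_square_iff[symmetric])
  then have "summable (\<lambda>j. (norm ((ell2_nth z j \<bullet> u j) *\<^sub>R u j))\<^sup>2)"
    using assms by (intro summable_comparison_test'[OF summable_ell2[of z], of 0]) simp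
  then show ?thesis
    by (simp add: line_proj_def Abs_ell2_inverse)
qed

lemma prox_indicator_fun_line_sum:
  assumes u: "\<And>j. norm (u j) = 1" and "\<gamma> > 0"
  shows "prox \<gamma> (indicator_fun (line_sum u)) z = line_proj u z"
proof (rule prox_indicator_fun_subspace[OF subspace_line_sum _ \<open>\<gamma> > 0\<close>])
  have uu: "u j \<bullet> u j = 1" for j
    using u[of j] by (simp add: norm_eq_1)
  show "line_proj u z \<in> line_sum u"
    by (simp add: line_sum_def ell2_nth_line_proj u uu)
  fix y assume y: "y \<in> line_sum u"
  have "ell2_nth (z - line_proj u z) j \<bullet> ell2_nth y j = 0" for j
  proof -
    have "ell2_nth y j = (ell2_nth y j \<bullet> u j) *\<^sub>R u j"
      using y by (simp add: line_sum_def)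
    moreover have "ell2_nth (z - line_proj u z) j \<bullet> u j = 0"
      by (simp add: minus_ell2.rep_eq ell2_nth_line_proj u uu inner_diff_left)
    ultimately show ?thesis
      by (metis inner_scaleR_right mult_zero_right)
  qed
  then show "(z - line_proj u z) \<bullet> y = 0"
    by (simp add: inner_ell2_def)
qed

lemma ell2_nth_reflection:
  assumes "\<And>j. norm (u j) = 1" "\<gamma> > 0"
  shows "ell2_nth (reflection \<gamma> (indicator_fun (line_sum u)) z) j =
    (2 * (ell2_nth z j \<bullet> u j)) *\<^sub>R u j - ell2_nth z j"
  by (simp add: reflection_def prox_indicator_fun_line_sum assms minus_ell2.rep_eq
      scaleR_ell2.rep_eq ell2_nth_line_proj)

lemma norm_vec2_power2: "(norm (w :: real ^ 2))\<^sup>2 = (w $ 1)\<^sup>2 + (w $ 2)\<^sup>2"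
  unfolding power2_norm_eq_inner by (simp add: inner_vec_def sum_2 power2_eq_square)

text \<open>Let \<open>c\<close> and \<open>s\<close> be the cosine and sine of an angle t.
  Reflecting in the first axis and then in the line at angle t is the rotation by 2t, and the mean
  of the identity and that rotation is \<open>c\<close> times the rotation by t.\<close>

lemma norm_line_rotation_step:
  fixes w :: "real ^ 2"
  assumes "c \<ge> 0" "c\<^sup>2 + s\<^sup>2 = 1"
    and r: "r = (2 * (w \<bullet> vector [1, 0])) *\<^sub>R vector [1, 0] - w"
  shows "norm ((1/2) *\<^sub>R w + (1/2) *\<^sub>R ((2 * (r \<bullet> vector [c, s])) *\<^sub>R vector [c, s] - r)) = c * norm w"
    (is "norm ?w' = _")
proof -
  have ip: "a \<bullet> vector [p, q] = a $ 1 * p + a $ 2 * q" for a :: "real ^ 2" and p q :: real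
    by (simp add: inner_vec_def sum_2)
  have s2: "s * s = 1 - c * c"
    using assms(2) by (simp add: power2_eq_square)
  \<comment> \<open>\<open>w1\<close> and \<open>w2\<close> together exhibit \<open>?w'\<close> as
    \<open>c\<close> times the rotation matrix with entries \<open>c\<close>, \<open>s\<close>
    applied to \<open>w\<close>.\<close>
  have w1: "?w' $ 1 = c * (c * w $ 1 - s * w $ 2)"
    by (simp add: r ip field_simps)
  have "?w' $ 2 = w $ 2 + s * c * w $ 1 - (s * s) * w $ 2"
    by (simp add: r ip field_simps)
  then have w2: "?w' $ 2 = c * (s * w $ 1 + c * w $ 2)"
    unfolding s2 by (simp add: algebra_simps)
  have "(norm ?w')\<^sup>2 = c\<^sup>2 * ((c\<^sup>2 + s\<^sup>2) * ((w $ 1)\<^sup>2 + (w $ 2)\<^sup>2))"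
    unfolding norm_vec2_power2 w1 w2 by (simp add: power2_eq_square algebra_simps)
  also have "\<dots> = (c * norm w)\<^sup>2"
    by (simp only: assms(2) norm_vec2_power2 power_mult_distrib mult_1)
  finally show ?thesis
    using \<open>c \<ge> 0\<close> by (simp add: power2_eq_iff_nonneg)
qed

text \<open>Dominated convergence for series. It is needed because the decay rates of the
  coordinates will approach 1, so no common geometric rate is available.\<close>

lemma tendsto_norm_ell2_0:
  assumes dom: "\<And>k j. norm (ell2_nth (z k) j) \<le> norm (ell2_nth y j)"
    and lim: "\<And>j. (\<lambda>k. ell2_nth (z k) j) \<longlonglongrightarrow> 0"
  shows "(\<lambda>k. norm (z k)) \<longlonglongrightarrow> 0"
proof -
  have "(\<lambda>k. \<Sum>j. (norm (ell2_nth (z k) j))\<^sup>2) \<longlonglongrightarrow> (\<Sum>j. 0)"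
  proof (rule tannerys_theorem[THEN conjunct2, THEN conjunct2])
    show "((\<lambda>k. (norm (ell2_nth (z k) j))\<^sup>2) \<longlongrightarrow> 0) sequentially" for j
      using tendsto_power[OF tendsto_norm[OF lim[of j]], of 2] by simp
    show "\<forall>\<^sub>F (j, k) in at_top \<times>\<^sub>F sequentially. norm ((norm (ell2_nth (z k) j))\<^sup>2) \<le> (norm (ell2_nth y j))\<^sup>2"
      by (intro always_eventually) (auto intro!: power_mono dom)
  qed (use summable_ell2 in auto)
  then have "(\<lambda>k. sqrt ((norm (z k))\<^sup>2)) \<longlonglongrightarrow> sqrt 0"
    unfolding norm_ell2_power2 by (intro tendsto_real_sqrt) simp
  then show ?thesis
    by simp
qed

text \<open>Membership in the first space kills the second entry of each coordinate; as
  \<open>s j\<close> is nonzero, the coefficient along the second line must then vanish too.\<close>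

lemma line_sum_Int_trivial:
  assumes "\<And>j. s j \<noteq> 0"
  shows "line_sum (\<lambda>_. vector [1, 0]) \<inter> line_sum (\<lambda>j. vector [c j, s j] :: real ^ 2) = {0}"
proof -
  have "z = 0" if z: "z \<in> line_sum (\<lambda>_. vector [1, 0])"
    and z': "z \<in> line_sum (\<lambda>j. vector [c j, s j] :: real ^ 2)" for z :: "(real ^ 2) ell2"
  proof -
    have "ell2_nth z j = 0" for j
    proof -
      let ?w = "ell2_nth z j"
      have "?w = (?w \<bullet> vector [1, 0]) *\<^sub>R vector [1, 0]"
        using z by (simp add: line_sum_def)
      from arg_cong[OF this, of "\<lambda>w. w $ 2"] have w2: "?w $ 2 = 0"
        by simp
      have w: "?w = (?w \<bullet> vector [c j, s j]) *\<^sub>R vector [c j, s j]"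
        using z' by (simp add: line_sum_def)
      from arg_cong[OF this, of "\<lambda>w. w $ 2"] have "?w \<bullet> vector [c j, s j] = 0"
        using w2 assms[of j] by simp
      with w show ?thesis by simp
    qed
    then show ?thesis
      by (simp add: ell2_nth_inject[symmetric] zero_ell2.rep_eq fun_eq_iff)
  qed
  then show ?thesis
    using subspace_0[OF subspace_line_sum] by blast
qed

lemma exists_decay_rates:
  fixes h :: "nat \<Rightarrow> real" and a :: "nat \<Rightarrow> real"
  assumes "h \<longlonglongrightarrow> 0" "\<And>j. a j > 0" "\<And>k. h k \<le> a 0"
  obtains c where "\<And>j. 0 < c j" "\<And>j. c j < 1" "\<And>k. \<exists>j. exp (-1) * h k \<le> c j ^ k * a j"
proof -
  \<comment> \<open>Asking for \<open>n\<close> at least \<open>j\<close> makes \<open>N\<close>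
    unbounded, so that every \<open>k\<close> is below some \<open>N (Suc j)\<close>.\<close>
  have "\<exists>n\<ge>j. \<forall>k\<ge>n. h k \<le> a j" for j
  proof -
    obtain n where "\<forall>k\<ge>n. h k < a j"
      using order_tendstoD(2)[OF assms(1,2)] unfolding eventually_sequentially by blast
    then show ?thesis
      by (intro exI[of _ "max n j"]) (auto simp: less_imp_le)
  qed
  then obtain N where N: "\<And>j. j \<le> N j" "\<And>j k. N j \<le> k \<Longrightarrow> h k \<le> a j"
    by metis
  \<comment> \<open>Then \<open>c j ^ k\<close> is the exponential of
    \<open>- k / (N (Suc j) + 1)\<close>, which is at least \<open>exp (-1)\<close> as long as
    \<open>k\<close> does not exceed \<open>N (Suc j)\<close>.\<close>
  define c where "c j = exp (- 1 / (real (N (Suc j)) + 1))" for j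
  have "\<exists>j. exp (-1) * h k \<le> c j ^ k * a j" for k
  proof -
    \<comment> \<open>For positive \<open>j\<close>, minimality places \<open>k\<close> strictly
      above \<open>N j\<close>, which bounds \<open>h k\<close> by \<open>a j\<close>. For
      \<open>j = 0\<close> there is no such lower end, and the bound by \<open>a 0\<close> is the
      separate hypothesis.\<close>
    define j where "j = (LEAST j. k \<le> N (Suc j))"
    have kj: "k \<le> N (Suc j)"
      unfolding j_def by (rule LeastI[of _ k]) (use N(1)[of "Suc k"] in simp)
    have "h k \<le> a j"
    proof (cases j)
      case (Suc i)
      then have "\<not> k \<le> N (Suc i)"
        using not_less_Least[of i "\<lambda>j. k \<le> N (Suc j)"] by (simp add: j_def)
      then show ?thesis
        using N(2)[of j k] Suc by simp
    qed (use assms(3) in simp)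
    moreover have "exp (-1) \<le> c j ^ k"
      using kj by (simp add: c_def exp_of_nat_mult[symmetric] field_simps)
    ultimately have "exp (-1) * h k \<le> c j ^ k * a j"
      using assms(2)[of j] by (meson exp_ge_zero less_imp_le mult_left_mono mult_right_mono order_trans)
    then show ?thesis ..
  qed
  then show ?thesis
    by (intro that[of c]) (simp_all add: c_def)
qed

theorem theorem9:
  shows "\<exists>z0 :: (real ^ 2) ell2. \<forall>h :: real \<Rightarrow> real.
    h ` {0..} \<subseteq> {0<..<1} \<longrightarrow> strict_antimono_on {0..} h \<longrightarrow> (h \<longlongrightarrow> 0) at_top \<longrightarrow>
    (\<exists>U V :: (real ^ 2) ell2 set.
      subspace U \<and> closed U \<and> subspace V \<and> closed V \<and> U \<inter> V = {0} \<and>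
      (\<forall>\<gamma>>0. \<exists>zstar.
        let z = relaxed_PRS \<gamma> (\<lambda>_. 1/2) (indicator_fun V) (indicator_fun U) z0 in
        T_PRS \<gamma> (indicator_fun V) (indicator_fun U) zstar = zstar \<and>
        (\<forall>k. norm (z k - zstar) \<ge> exp (-1) * h (real k)) \<and>
        (\<lambda>j. norm (z j - zstar)) \<longlonglongrightarrow> 0))"
proof -
  \<comment> \<open>The starting point has to be fixed before \<open>h\<close> is known:
    \<open>a 0 = 1\<close> lies above all values of any admissible \<open>h\<close>, and every
    \<open>a j\<close> is positive.\<close>
  define a :: "nat \<Rightarrow> real" where "a j = (1/2) ^ j" for j
  define z0 :: "(real ^ 2) ell2" where "z0 = Abs_ell2 (\<lambda>j. vector [a j, 0])"
  have norm_a: "norm (vector [a j, 0] :: real ^ 2) = a j" for j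
    by (rule power2_eq_imp_eq) (simp_all add: norm_vec2_power2 a_def)
  have "summable (\<lambda>j. (norm (vector [a j, 0] :: real ^ 2))\<^sup>2)"
    \<comment> \<open>The squares form the geometric series with ratio 1/4.\<close>
    unfolding norm_a unfolding a_def power_mult[symmetric] mult.commute[of _ 2]
    by (simp add: power_mult power2_eq_square)
  then have norm_z0: "norm (ell2_nth z0 j) = a j" for j
    by (simp add: z0_def Abs_ell2_inverse norm_a)
  show ?thesis
  proof (rule exI[of _ z0], intro allI impI)
    fix h :: "real \<Rightarrow> real"
    assume h: "h ` {0..} \<subseteq> {0<..<1}" and lim: "(h \<longlongrightarrow> 0) at_top"
    have "h (real k) \<le> a 0" for k
      using image_subset_iff[THEN iffD1, OF h, rule_format, of "real k"] by (simp add: a_def)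
    moreover have "(\<lambda>k. h (real k)) \<longlonglongrightarrow> 0"
      by (rule filterlim_compose[OF lim filterlim_real_sequentially])
    ultimately obtain c where c: "\<And>j. 0 < c j" "\<And>j. c j < 1"
      and hc: "\<And>k. \<exists>j. exp (-1) * h (real k) \<le> c j ^ k * a j"
      using exists_decay_rates[of "\<lambda>k. h (real k)" a] by (auto simp: a_def)
    \<comment> \<open>The sine belonging to the cosine \<open>c j\<close>; it is nonzero because
      \<open>c j\<close> is below 1, so the two lines in each plane are distinct.\<close>
    define s where "s j = sqrt (1 - (c j)\<^sup>2)" for j
    have c2: "(c j)\<^sup>2 < 1" for j
      using c[of j] by (simp add: power_less_one_iff)
    have cs: "(c j)\<^sup>2 + (s j)\<^sup>2 = 1" for j
      using c2[of j] by (simp add: s_def)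
    define u :: "nat \<Rightarrow> real ^ 2" where "u = (\<lambda>_. vector [1, 0])"
    define v :: "nat \<Rightarrow> real ^ 2" where "v = (\<lambda>j. vector [c j, s j])"
    have unit: "norm (u j) = 1" "norm (v j) = 1" for j
      by (rule power2_eq_imp_eq; simp add: norm_vec2_power2 u_def v_def cs)+
    let ?U = "line_sum u" and ?V = "line_sum v"
    have "?U \<inter> ?V = {0}"
      unfolding u_def v_def using c2 by (intro line_sum_Int_trivial) (simp add: s_def order_less_imp_not_eq)
    \<comment> \<open>The fixed point is 0 for every \<gamma>. Here \<open>z\<close> is given by an
      equation, to fit the goal after its \<open>let\<close> is unfolded.\<close>
    moreover have "T_PRS \<gamma> (indicator_fun ?V) (indicator_fun ?U) 0 = 0 \<and>
        (\<forall>k. norm (z k - 0) \<ge> exp (-1) * h (real k)) \<and> (\<lambda>j. norm (z j - 0)) \<longlonglongrightarrow> 0"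
      if "\<gamma> > 0" and z: "z = relaxed_PRS \<gamma> (\<lambda>_. 1/2) (indicator_fun ?V) (indicator_fun ?U) z0" for \<gamma> z
    proof -
      let ?T = "T_PRS \<gamma> (indicator_fun ?V) (indicator_fun ?U)"
      have "?T 0 = 0"
        by (simp add: T_PRS_def ell2_nth_inject[symmetric] fun_eq_iff ell2_nth_reflection
            unit \<open>\<gamma> > 0\<close> zero_ell2.rep_eq)
      moreover have step: "norm (ell2_nth ((1/2) *\<^sub>R y + (1/2) *\<^sub>R ?T y) j) = c j * norm (ell2_nth y j)" for y j
      proof -
        define r where "r = ell2_nth (reflection \<gamma> (indicator_fun ?U) y) j"
        have r: "r = (2 * (ell2_nth y j \<bullet> vector [1, 0])) *\<^sub>R vector [1, 0] - ell2_nth y j"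
          using ell2_nth_reflection[of u, OF unit(1) \<open>\<gamma> > 0\<close>, of y j] by (simp add: r_def u_def)
        have "ell2_nth (?T y) j = (2 * (r \<bullet> vector [c j, s j])) *\<^sub>R vector [c j, s j] - r"
          using ell2_nth_reflection[of v, OF unit(2) \<open>\<gamma> > 0\<close>, of "reflection \<gamma> (indicator_fun ?U) y" j]
          by (simp add: T_PRS_def r_def v_def)
        then show ?thesis
          using norm_line_rotation_step[OF less_imp_le[OF c(1)] cs r]
          by (simp add: plus_ell2.rep_eq scaleR_ell2.rep_eq)
      qed
      have norm_z: "norm (ell2_nth (z k) j) = c j ^ k * a j" for k j
      proof (induction k)
        case (Suc k)
        then show ?case
          using step[of "z k" j] by (simp add: z)
      qed (simp add: z norm_z0)
      \<comment> \<open>A single coordinate, chosen depending on \<open>k\<close>, already carries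
        the lower bound.\<close>
      have "exp (-1) * h (real k) \<le> norm (z k)" for k
      proof -
        obtain j where "exp (-1) * h (real k) \<le> c j ^ k * a j"
          using hc by blast
        also have "\<dots> \<le> norm (z k)"
          using norm_ell2_nth_le[of "z k" j] by (simp add: norm_z)
        finally show ?thesis .
      qed
      moreover have "(\<lambda>k. norm (z k)) \<longlonglongrightarrow> 0"
      \<comment> \<open>The starting point itself dominates, since the factors
        \<open>c j ^ k\<close> are at most 1; for fixed \<open>j\<close> they tend to 0.\<close>
      proof (rule tendsto_norm_ell2_0[of _ z0])
        show "norm (ell2_nth (z k) j) \<le> norm (ell2_nth z0 j)" for k j
          unfolding norm_z norm_z0 using c[of j]
          by (simp add: a_def mult_le_cancel_right1 power_le_one less_imp_le)
        show "(\<lambda>k. ell2_nth (z k) j) \<longlonglongrightarrow> 0" for j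
        proof (rule tendsto_norm_zero_cancel)
          show "(\<lambda>k. norm (ell2_nth (z k) j)) \<longlonglongrightarrow> 0"
            unfolding norm_z using c[of j] by (intro tendsto_mult_left_zero LIMSEQ_power_zero) simp
        qed
      qed
      ultimately show ?thesis
        by simp
    qed
    ultimately show "\<exists>U V :: (real ^ 2) ell2 set.
      subspace U \<and> closed U \<and> subspace V \<and> closed V \<and> U \<inter> V = {0} \<and>
      (\<forall>\<gamma>>0. \<exists>zstar.
        let z = relaxed_PRS \<gamma> (\<lambda>_. 1/2) (indicator_fun V) (indicator_fun U) z0 in
        T_PRS \<gamma> (indicator_fun V) (indicator_fun U) zstar = zstar \<and>
        (\<forall>k. norm (z k - zstar) \<ge> exp (-1) * h (real k)) \<and>
        (\<lambda>j. norm (z j - zstar)) \<longlonglongrightarrow> 0)"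
      unfolding Let_def
      by (intro exI[of _ ?U] exI[of _ ?V] conjI[OF subspace_line_sum] conjI[OF closed_line_sum]
          conjI[of "?U \<inter> ?V = {0}"] allI impI exI[of _ 0]) simp_all
  qed
qed

end
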